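(* In the standing setting of the context, assume: (a) there exists an open neighborhood $\mathcal{N}(t_0)\subset(0,1)^m$ of $t_0$ such that, for any $t\in\mathcal{N}(t_0)$, the $\phi$-projection $s^*=\mathcal{S}^*(t)$ of $t$ on $\mathcal{M}=\mathcal{S}(\bar\Theta)$ exists, is unique, and satisfies $s^*=\mathcal{S}(\theta^* )$ for some (unique) $\theta^*\in\mathring\Theta$; (b) with $\vartheta^*:\mathcal{N}(t_0)\to\mathring\Theta$ defined by $\vartheta^*(t)=\operatorname*{arg\,inf}_{\theta\in\mathring\Theta}D_\phi(\mathcal{S}(\theta)\mid t)$, the $k\times k$ matrix with entries $\frac{\partial^2 D_\phi(\mathcal{S}(\theta)\mid t_0)}{\partial\theta_i\partial\theta_j}\Big|_{\theta=\vartheta^*(t_0)}$, $i,j\in\{1,\dots,k\}$, is positive definite. Then the function $\mathcal{S}^*(t)=\operatorname*{arg\,inf}_{s\in\mathcal{M}}D_\phi(s\mid t)$, $t\in\mathcal{N}(t_0)$, is continuously differentiable at $t_0$ with Jacobian matrix at $t_0$ given by $$J[\mathcal{S}^*](t_0)=J[\mathcal{S}](\vartheta^*(t_0))\,J[\vartheta^*](t_0),$$ where $$J[\vartheta^*](t_0)=H(t_0)^{-1}\,J[\mathcal{S}](\vartheta^*(t_0))^\top\,\Delta(t_0),$$ $H(t_0)$ is the matrix in (b), which is the Hessian at $\vartheta^*(t_0)$ of $\theta\mapsto D_\phi(\mathcal{S}(\theta)\mid t_0)$, and $$\Delta(t_0)=\mathrm{diag}\left(\frac{\mathcal{S}_1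(\vartheta^*(t_0))}{t_{0,1}^2}\phi''\left(\frac{\mathcal{S}_1(\vartheta^*(t_0))}{t_{0,1}}\right),\dots,\frac{\mathcal{S}_m(\vartheta^*(t_0))}{t_{0,m}^2}\phi''\left(\frac{\mathcal{S}_m(\vartheta^*(t_0))}{t_{0,m}}\right)\right).$$
   Context: Fix a positive integer $m$. The function $\phi:[0,\infty)\to\mathbb{R}$ is convex and continuous at $0$. Define $f:[0,\infty)^2\to\mathbb{R}\cup\{\infty\}$ by $f(v,w)=w\,\phi(v/w)$ if $v\ge 0$, $w>0$; $f(v,0)=v\lim_{x\to\infty}\phi(x)/x$ if $v>0$ (the limit exists in $\mathbb{R}\cup\{\infty\}$); and $f(0,0)=0$. For $s,t\in[0,\infty)^m$, $D_\phi(s\mid t)=\sum_{i=1}^m f(s_i,t_i)$. A $\phi$-projection of $t$ on a nonempty set $\mathcal{M}$ is an element $s^*\in\mathcal{M}$ with $D_\phi(s^*\mid t)=\inf_{s\in\mathcal{M}}D_\phi(s\mid t)$. Standing assumptions: $\phi$ is strictly convex and twice continuously differentiable on $(0,\infty)$. For some positive integer $k\le m$, $\Theta\subset\mathbb{R}^k$ is bounded, with closure $\bar\Theta$ and nonempty interior $\mathring\Theta$; $\mathcal{S}=(\mathcal{S}_1,\dots,\mathcal{S}_m):\bar\Theta\to[0,1]^m$ is continuous, injective, twice continuously differentiable on $\mathring\Theta$, and satisfies $\mathcal{S}(\mathring\Theta)\subset(0,1)^m$; and $\mathcal{M}=\mathcal{S}(\bar\Theta)$. A point $t_0=(t_{0,1},\dots,t_{0,m})\in(0,1)^m$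 is fixed. $J[g](y)$ denotes the usual Jacobian matrix of a function $g$ at $y$ (rows indexed by components of $g$, columns by variables). "Continuously differentiable at $t_0$" means differentiable on an open neighborhood of $t_0$ with Jacobian continuous at $t_0$. *)

theory Defs
  imports "HOL-Analysis.Analysis"
begin

definition strictly_convex_on :: "real set \<Rightarrow> (real \<Rightarrow> real) \<Rightarrow> bool" where
  "strictly_convex_on I g \<longleftrightarrow>
     (\<forall>x\<in>I. \<forall>y\<in>I. \<forall>u. x \<noteq> y \<longrightarrow> 0 < u \<longrightarrow> u < 1 \<longrightarrow>
        g ((1 - u) * x + u * y) < (1 - u) * g x + u * g y)"

text \<open>The predicates \<open>C2_real_on\<close>, \<open>C1_on\<close> and \<open>C2_on\<close> are meant for open sets only.
  The columns of the Jacobian matrix are the partial derivatives.\<close>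

definition C2_real_on :: "real set \<Rightarrow> (real \<Rightarrow> real) \<Rightarrow> bool" where
  "C2_real_on U g \<longleftrightarrow>
     g differentiable_on U \<and> deriv g differentiable_on U \<and> continuous_on U (deriv (deriv g))"

definition C1_on :: "(real ^ 'n) set \<Rightarrow> (real ^ 'n \<Rightarrow> real ^ 'm) \<Rightarrow> bool" where
  "C1_on U g \<longleftrightarrow>
     (\<forall>x\<in>U. g differentiable (at x)) \<and> continuous_on U (\<lambda>x. jacobian g (at x))"

definition C2_on :: "(real ^ 'n) set \<Rightarrow> (real ^ 'n \<Rightarrow> real ^ 'm) \<Rightarrow> bool" where
  "C2_on U g \<longleftrightarrow> C1_on U g \<and> (\<forall>j. C1_on U (\<lambda>x. column j (jacobian g (at x))))"

definition continuously_differentiable_at :: "(real ^ 'n \<Rightarrow> real ^ 'm) \<Rightarrow> real ^ 'n \<Rightarrow> bool" where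
  "continuously_differentiable_at g x \<longleftrightarrow>
     (\<exists>U. open U \<and> x \<in> U \<and> (\<forall>y\<in>U. g differentiable (at y))) \<and>
     isCont (\<lambda>y. jacobian g (at y)) x"

definition partial_deriv :: "'n \<Rightarrow> (real ^ 'n \<Rightarrow> real) \<Rightarrow> real ^ 'n \<Rightarrow> real" where
  "partial_deriv i F x = deriv (\<lambda>h. F (x + h *\<^sub>R axis i 1)) 0"

definition hessian :: "(real ^ 'n \<Rightarrow> real) \<Rightarrow> real ^ 'n \<Rightarrow> real ^ 'n ^ 'n" where
  "hessian F x = (\<chi> i j. partial_deriv i (partial_deriv j F) x)"

definition positive_definite :: "real ^ 'n ^ 'n \<Rightarrow> bool" where
  "positive_definite A \<longleftrightarrow> transpose A = A \<and> (\<forall>x. x \<noteq> 0 \<longrightarrow> x \<bullet> (A *v x) > 0)"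

definition diag_matrix :: "('n \<Rightarrow> real) \<Rightarrow> real ^ 'n ^ 'n" where
  "diag_matrix d = (\<chi> i j. if i = j then d i else 0)"

text \<open>Here \<open>\<phi>\<close> stands for a function on the half-line \<open>{0..}\<close>, and \<open>phi_f\<close> and \<open>phi_div\<close> are only
  meaningful for nonnegative (componentwise) arguments. For convex \<open>\<phi>\<close> the limit exists and is
  not \<open>-\<infinity>\<close>.\<close>

definition phi_f :: "(real \<Rightarrow> real) \<Rightarrow> real \<Rightarrow> real \<Rightarrow> ereal" where
  "phi_f \<phi> v w =
     (if w > 0 then ereal (w * \<phi> (v / w))
      else if v > 0 then ereal v * Lim at_top (\<lambda>x. ereal (\<phi> x / x))
      else 0)"

definition phi_div :: "(real \<Rightarrow> real) \<Rightarrow> real ^ 'm \<Rightarrow> real ^ 'm \<Rightarrow> ereal" where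
  "phi_div \<phi> s t = (\<Sum>i\<in>UNIV. phi_f \<phi> (s $ i) (t $ i))"

definition is_phi_projection ::
  "(real \<Rightarrow> real) \<Rightarrow> (real ^ 'm) set \<Rightarrow> real ^ 'm \<Rightarrow> real ^ 'm \<Rightarrow> bool" where
  "is_phi_projection \<phi> M t s \<longleftrightarrow> s \<in> M \<and> phi_div \<phi> s t = (INF s'\<in>M. phi_div \<phi> s' t)"

text \<open>The following two functions are determined by their defining property only where a unique
  minimizer exists.\<close>

definition phi_proj :: "(real \<Rightarrow> real) \<Rightarrow> (real ^ 'm) set \<Rightarrow> real ^ 'm \<Rightarrow> real ^ 'm" where
  "phi_proj \<phi> M t = arg_min_on (\<lambda>s. phi_div \<phi> s t) M"

definition theta_star ::
  "(real \<Rightarrow> real) \<Rightarrow> (real ^ 'k \<Rightarrow> real ^ 'm) \<Rightarrow> (real ^ 'k) set \<Rightarrow> real ^ 'm \<Rightarrow> real ^ 'k" where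
  "theta_star \<phi> S \<Theta> t = arg_min_on (\<lambda>\<theta>. phi_div \<phi> (S \<theta>) t) (interior \<Theta>)"

text \<open>For \<open>t\<close> with positive components \<open>phi_div\<close> is finite, so \<open>real_of_ereal\<close> loses nothing.\<close>

definition phi_hessian ::
  "(real \<Rightarrow> real) \<Rightarrow> (real ^ 'k \<Rightarrow> real ^ 'm) \<Rightarrow> real ^ 'm \<Rightarrow> real ^ 'k \<Rightarrow> real ^ 'k ^ 'k" where
  "phi_hessian \<phi> S t = hessian (\<lambda>\<theta>. real_of_ereal (phi_div \<phi> (S \<theta>) t))"

definition phi_Delta :: "(real \<Rightarrow> real) \<Rightarrow> real ^ 'm \<Rightarrow> real ^ 'm \<Rightarrow> real ^ 'm ^ 'm" where
  "phi_Delta \<phi> s t = diag_matrix (\<lambda>i. s $ i / (t $ i)\<^sup>2 * deriv (deriv \<phi>) (s $ i / t $ i))"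

end

(* For t in N the parameter theta*(t) is the unique minimizer over the compact closure of Theta of a
   jointly continuous function, so it depends continuously on t. Being an interior minimizer, it is a
   zero of the score, the gradient of theta |-> D_phi(S(theta) | t), which is continuously
   differentiable in (theta, t). Given continuity, differentiating this equation implicitly needs no
   inverse function theorem: it yields the derivative of theta* wherever the theta-derivative of the
   score is invertible. At (theta*(t0), t0) this derivative is the transpose of H(t0), hence H(t0) by
   the symmetry contained in positive definiteness; by continuity it stays invertible near t0. *)

theory Submission
  imports Defs
begin

section \<open>Componentwise derivatives; limits of determinants and inverse matrices\<close>

lemma has_derivative_vec_componentwise:
  fixes f :: "'a::real_normed_vector \<Rightarrow> real ^ 'n"
  assumes "\<And>i. ((\<lambda>x. f x $ i) has_derivative (\<lambda>h. f' h $ i)) (at x within X)"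
  shows "(f has_derivative f') (at x within X)"
  unfolding has_derivative_componentwise_within[of f]
  using assms by (auto simp: Basis_vec_def inner_axis)

lemma tendsto_det:
  fixes A :: "'a \<Rightarrow> real ^ 'n ^ 'n"
  assumes "(A \<longlongrightarrow> L) F"
  shows "((\<lambda>x. det (A x)) \<longlongrightarrow> det L) F"
  unfolding det_def by (intro tendsto_intros assms)

lemma tendsto_matrix_matrix_mult:
  fixes A :: "'a \<Rightarrow> real ^ 'n ^ 'm" and B :: "'a \<Rightarrow> real ^ 'p ^ 'n"
  assumes "(A \<longlongrightarrow> L) F" and "(B \<longlongrightarrow> M) F"
  shows "((\<lambda>x. A x ** B x) \<longlongrightarrow> L ** M) F"
  unfolding matrix_matrix_mult_def by (intro tendsto_intros assms)

lemma matrix_inv_mult: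
  fixes A :: "real ^ 'n ^ 'n"
  assumes "det A \<noteq> 0"
  shows "A ** matrix_inv A = mat 1" and "matrix_inv A ** A = mat 1"
proof -
  have "\<exists>A'. A ** A' = mat 1 \<and> A' ** A = mat 1"
    using assms by (simp add: invertible_det_nz[symmetric] invertible_def)
  then have "A ** matrix_inv A = mat 1 \<and> matrix_inv A ** A = mat 1"
    unfolding matrix_inv_def by (rule someI_ex)
  then show "A ** matrix_inv A = mat 1" and "matrix_inv A ** A = mat 1"
    by auto
qed

text \<open>Cramer's rule for \<open>A *v x = axis l 1\<close>, whose solution is column
  \<open>l\<close> of the inverse. As a quotient of determinants, the entry visibly depends
  continuously on \<open>A\<close>.\<close>

lemma matrix_inv_nth:
  fixes A :: "real ^ 'n ^ 'n"
  assumes "det A \<noteq> 0"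
  shows "matrix_inv A $ k $ l = det (\<chi> i j. if j = k then axis l 1 $ i else A $ i $ j) / det A"
proof -
  have "A *v column l (matrix_inv A) = axis l 1"
    using matrix_inv_mult(1)[OF assms]
    by (metis matrix_vector_mul_assoc matrix_vector_mul_lid matrix_vector_mult_basis)
  then have "column l (matrix_inv A) = (\<chi> k. det (\<chi> i j. if j = k then axis l 1 $ i else A $ i $ j) / det A)"
    by (subst (asm) cramer[OF assms])
  then show ?thesis
    by (simp add: column_def vec_eq_iff)
qed

lemma tendsto_matrix_inv:
  fixes A :: "'a \<Rightarrow> real ^ 'n ^ 'n"
  assumes A: "(A \<longlongrightarrow> L) F" and nz: "det L \<noteq> 0"
  shows "((\<lambda>x. matrix_inv (A x)) \<longlongrightarrow> matrix_inv L) F"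
proof (intro vec_tendstoI)
  fix k l
  let ?C = "\<lambda>M. (\<chi> i j. if j = k then axis l 1 $ i else M $ i $ j) :: real ^ 'n ^ 'n"
  have C: "((\<lambda>x. ?C (A x)) \<longlongrightarrow> ?C L) F"
  proof (intro vec_tendstoI)
    fix i j
    show "((\<lambda>x. ?C (A x) $ i $ j) \<longlongrightarrow> ?C L $ i $ j) F"
      by (cases "j = k") (auto intro!: tendsto_intros A)
  qed
  have "((\<lambda>x. det (?C (A x)) / det (A x)) \<longlongrightarrow> matrix_inv L $ k $ l) F"
    unfolding matrix_inv_nth[OF nz] by (intro tendsto_divide tendsto_det C A nz)
  \<comment> \<open>Cramer's formula is available where the determinant is nonzero, which holds
    eventually because it holds in the limit.\<close>
  moreover have "\<forall>\<^sub>F x in F. det (A x) \<noteq> 0"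
    using tendsto_imp_eventually_ne[OF tendsto_det[OF A] nz] .
  then have "\<forall>\<^sub>F x in F. det (?C (A x)) / det (A x) = matrix_inv (A x) $ k $ l"
    by eventually_elim (simp add: matrix_inv_nth)
  ultimately show "((\<lambda>x. matrix_inv (A x) $ k $ l) \<longlongrightarrow> matrix_inv L $ k $ l) F"
    by (rule Lim_transform_eventually)
qed

text \<open>A nonzero kernel vector would make the quadratic form vanish.\<close>

lemma positive_definite_det_nz:
  assumes "positive_definite A"
  shows "det A \<noteq> 0"
proof
  assume "det A = 0"
  then obtain x where "x \<noteq> 0" "A *v x = 0"
    by (metis invertible_det_nz invertible_left_inverse matrix_left_invertible_ker)
  then show False
    using assms by (auto simp: positive_definite_def dest!: spec[of _ x])
qed

section \<open>Implicit differentiation and continuity of minimizers\<close>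

text \<open>Write \<open>u = g t - g t0\<close> and \<open>k = t - t0\<close>. Since
  \<open>F\<close> is constant along the graph near \<open>t0\<close>, \<open>A u + B k\<close> is
  of smaller order than \<open>norm u + norm k\<close>; applying the left inverse \<open>A'\<close>
  turns this into an estimate for \<open>u + A' (B k)\<close>. Absorbing \<open>u\<close> gives a
  Lipschitz bound at \<open>t0\<close>, after which the error is of smaller order than
  \<open>norm k\<close> alone.\<close>

lemma has_derivative_implicit:
  fixes F :: "'a::real_normed_vector \<times> 'b::real_normed_vector \<Rightarrow> 'c::real_normed_vector"
  assumes F: "(F has_derivative (\<lambda>z. A (fst z) + B (snd z))) (at (g t0, t0))"
    and g: "isCont g t0"
    and zero: "\<forall>\<^sub>F t in at t0. F (g t, t) = F (g t0, t0)"
    and A: "linear A" and A': "bounded_linear A'" and inv: "\<And>x. A' (A x) = x"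
  shows "(g has_derivative (\<lambda>k. - A' (B k))) (at t0)"
proof -
  interpret A': bounded_linear A' by fact
  \<comment> \<open>Restricting the derivative of \<open>F\<close> to pairs \<open>(0, k)\<close>
    leaves \<open>B k\<close>, since \<open>A 0 = 0\<close>; so \<open>B\<close> inherits
    boundedness.\<close>
  have "bounded_linear ((\<lambda>z. A (fst z) + B (snd z)) \<circ> (\<lambda>k. (0, k)))"
    unfolding o_def
    by (rule bounded_linear_compose[OF has_derivative_bounded_linear[OF F]])
       (intro bounded_linear_intros)
  then have B: "bounded_linear B"
    by (simp add: o_def linear_0[OF A])
  have L: "bounded_linear (\<lambda>k. - A' (B k))"
    by (intro bounded_linear_minus bounded_linear_compose[OF A' B])
  obtain C where C: "C > 0" "\<And>x. norm (A' x) \<le> norm x * C"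
    using A'.pos_bounded by blast
  obtain D where D: "D > 0" "\<And>x. norm (- A' (B x)) \<le> norm x * D"
    using bounded_linear.pos_bounded[OF L] by blast
  have key: "\<forall>\<^sub>F t in at t0. norm (g t - g t0 + A' (B (t - t0)))
      \<le> C * e * (norm (g t - g t0) + norm (t - t0))" if "e > 0" for e
  proof -
    let ?P = "\<lambda>y. norm (F y - F (g t0, t0) - (A (fst (y - (g t0, t0))) + B (snd (y - (g t0, t0)))))
      \<le> e * norm (y - (g t0, t0))"
    have "\<forall>\<^sub>F y in at (g t0, t0). ?P y"
      using F \<open>e > 0\<close> unfolding has_derivative_within_alt2 by blast
    \<comment> \<open>At the point itself both sides are zero, so the estimate holds on a full
      neighborhood and can be composed with the convergence of \<open>(g t, t)\<close>.\<close>
    then have "\<forall>\<^sub>F y in nhds (g t0, t0). ?P y"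
      using linear_0[OF A] linear_0[OF bounded_linear.linear[OF B]] by (simp add: eventually_nhds_conv_at)
    moreover have "filterlim (\<lambda>t. (g t, t)) (nhds (g t0, t0)) (at t0)"
      using g by (intro tendsto_intros) (simp add: isCont_def)
    ultimately have "\<forall>\<^sub>F t in at t0. ?P (g t, t)"
      by (rule eventually_compose_filterlim)
    with zero show ?thesis
    proof eventually_elim
      case (elim t)
      let ?u = "g t - g t0" and ?k = "t - t0"
      have "norm (?u + A' (B ?k)) = norm (A' (A ?u + B ?k))"
        by (simp add: A'.add inv)
      also have "\<dots> \<le> norm (A ?u + B ?k) * C"
        by (rule C)
      also have "norm (A ?u + B ?k) \<le> e * norm (?u, ?k)"
        using elim by (simp flip: norm_minus_cancel[of "A ?u + B ?k"])
      also have "\<dots> \<le> e * (norm ?u + norm ?k)"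
        using \<open>e > 0\<close> by (intro mult_left_mono norm_Pair_le) auto
      finally show ?case
        using C(1) by (simp add: mult_ac)
    qed
  qed
  \<comment> \<open>For \<open>e = 1 / (2 * C)\<close> the key estimate reads
    \<open>norm (u + A' (B k)) \<le> (norm u + norm k) / 2\<close>. As
    \<open>norm (A' (B k)) \<le> D * norm k\<close>, solving for \<open>norm u\<close> gives the
    factor \<open>2 * D + 1\<close>.\<close>
  define K where "K = 2 * D + 1"
  have "K > 0" using D by (simp add: K_def)
  have lip: "\<forall>\<^sub>F t in at t0. norm (g t - g t0) \<le> K * norm (t - t0)"
  proof -
    have "0 < 1 / (2 * C)" using C(1) by simp
    from key[OF this] show ?thesis
    proof eventually_elim
      case (elim t)
      have "norm (g t - g t0) \<le> norm (g t - g t0 + A' (B (t - t0))) + norm (- A' (B (t - t0)))"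
        using norm_triangle_ineq[of "g t - g t0 + A' (B (t - t0))" "- A' (B (t - t0))"] by simp
      with elim D(2)[of "t - t0"] C(1) show ?case
        by (simp add: K_def algebra_simps)
    qed
  qed
  show ?thesis
    unfolding has_derivative_within_alt2
  proof (intro conjI L allI impI)
    fix e :: real assume "e > 0"
    \<comment> \<open>The Lipschitz bound gives
      \<open>norm u + norm k \<le> (K + 1) * norm k\<close>; dividing \<open>e\<close> by
      \<open>C * (K + 1)\<close> makes the final error exactly \<open>e * norm k\<close>.\<close>
    then have "e / (C * (K + 1)) > 0"
      using C(1) \<open>K > 0\<close> by simp
    from key[OF this] lip
    show "\<forall>\<^sub>F t in at t0. norm (g t - g t0 - - A' (B (t - t0))) \<le> e * norm (t - t0)"
    proof eventually_elim
      case (elim t)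
      have "norm (g t - g t0 + A' (B (t - t0)))
          \<le> C * (e / (C * (K + 1))) * ((K + 1) * norm (t - t0))"
        using elim C(1) \<open>e > 0\<close> \<open>K > 0\<close>
        by (elim order_trans) (intro mult_left_mono, auto simp: algebra_simps)
      also have "\<dots> = e * norm (t - t0)"
        using C(1) \<open>K > 0\<close> by simp
      finally show ?case by simp
    qed
  qed
qed

text \<open>The graph of \<open>g\<close> consists of the pairs \<open>(t, x)\<close> with
  \<open>f t x \<le> f t y\<close> for every \<open>y\<close> in \<open>K\<close>, an intersection
  of relatively closed sets; a map into a compact set with closed graph is continuous.\<close>

lemma continuous_on_unique_minimizer:
  fixes f :: "'a::euclidean_space \<Rightarrow> 'b::euclidean_space \<Rightarrow> real"
  assumes K: "compact K"
    and f: "continuous_on (T \<times> K) (\<lambda>(t, x). f t x)"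
    and g: "\<And>t. t \<in> T \<Longrightarrow> g t \<in> K"
    and min: "\<And>t x. t \<in> T \<Longrightarrow> x \<in> K \<Longrightarrow> f t (g t) \<le> f t x"
    and uniq: "\<And>t x. t \<in> T \<Longrightarrow> x \<in> K \<Longrightarrow> f t x \<le> f t (g t) \<Longrightarrow> x = g t"
  shows "continuous_on T g"
proof (cases "K = {}")
  \<comment> \<open>An intersection over an empty \<open>K\<close> would be the whole space, so this
    case is treated apart; \<open>T\<close> is then empty because \<open>g\<close> maps it into
    \<open>K\<close>.\<close>
  case True
  with g have "T = {}" by auto
  then show ?thesis by simp
next
  case False
  have graph: "(\<lambda>t. (t, g t)) ` T = (\<Inter>y\<in>K. {z \<in> T \<times> K. f (fst z) (snd z) - f (fst z) y \<in> {..0}})"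
    (is "?L = ?R")
  proof
    show "?L \<subseteq> ?R" using g min by auto
    show "?R \<subseteq> ?L"
    proof
      fix z assume z: "z \<in> ?R"
      then have "z \<in> T \<times> K" using False by auto
      with z g uniq[of "fst z" "snd z"] have "snd z = g (fst z)" by force
      with \<open>z \<in> T \<times> K\<close> show "z \<in> ?L" by (cases z) auto
    qed
  qed
  have "closedin (top_of_set (T \<times> K)) ?R"
  proof (rule closedin_INT[OF False])
    fix y assume "y \<in> K"
    have "continuous_on (T \<times> K) ((\<lambda>(t, x). f t x) \<circ> (\<lambda>z. (fst z, y)))"
      using \<open>y \<in> K\<close>
      by (intro continuous_on_compose continuous_intros continuous_on_subset[OF f]) auto
    then have "continuous_on (T \<times> K) (\<lambda>z. f (fst z) (snd z) - f (fst z) y)"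
      using f by (intro continuous_intros) (simp_all add: case_prod_unfold o_def)
    from continuous_closedin_preimage[OF this closed_atMost[of 0]]
    show "closedin (top_of_set (T \<times> K)) {z \<in> T \<times> K. f (fst z) (snd z) - f (fst z) y \<in> {..0}}"
      by (simp add: vimage_def Int_def)
  qed
  with graph show ?thesis
    using continuous_closed_graph_eq[OF K, of g T] g by auto
qed

section \<open>Matrix-vector identities, Jacobians and partial derivatives\<close>

lemma diag_matrix_mult_nth: "(diag_matrix d *v x) $ i = d i * x $ i"
  by (simp add: matrix_vector_mult_def diag_matrix_def if_distrib[of "\<lambda>a. a * _"] cong: if_cong)

lemma transpose_mult_nth:
  fixes A :: "real ^ 'n ^ 'm"
  shows "(transpose A *v x) $ j = column j A \<bullet> x"
  by (simp add: matrix_vector_mul_component transpose_def column_def)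

lemma uminus_matrix_vector_mult:
  fixes A :: "real ^ 'n ^ 'm"
  shows "- A *v x = - (A *v x)"
  by (simp add: vec_eq_iff matrix_vector_mul_component)

lemma jacobian_eqI:
  fixes A :: "real ^ 'n ^ 'm"
  assumes "(f has_derivative (*v) A) (at x)"
  shows "jacobian f (at x) = A"
  by (simp add: jacobian_def matrix_of_matrix_vector_mul flip: frechet_derivative_at[OF assms])

lemma partial_deriv_eq:
  assumes "(F has_derivative F') (at x)"
  shows "partial_deriv i F x = F' (axis i 1)"
proof -
  have "((\<lambda>h. x + h *\<^sub>R axis i 1) has_derivative (\<lambda>h. h *\<^sub>R axis i 1)) (at 0)"
    by (auto intro!: derivative_eq_intros)
  then have "((\<lambda>h. F (x + h *\<^sub>R axis i 1)) has_derivative (\<lambda>h. F' (h *\<^sub>R axis i 1))) (at 0)"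
    by (rule has_derivative_compose) (use assms in simp)
  moreover have "F' (h *\<^sub>R axis i 1) = F' (axis i 1) * h" for h
    using linear_scale[OF has_derivative_linear[OF assms]] by simp
  ultimately show ?thesis
    unfolding partial_deriv_def by (intro DERIV_imp_deriv) (simp add: has_field_derivative_def)
qed

section \<open>First and second derivatives of the divergence in the parameter\<close>

text \<open>Real-valued form of \<open>phi_div\<close>, suited to differentiation; the two agree for
  \<open>t\<close> with positive components.\<close>

definition phi_sum :: "(real \<Rightarrow> real) \<Rightarrow> real ^ 'm \<Rightarrow> real ^ 'm \<Rightarrow> real" where
  "phi_sum \<phi> s t = (\<Sum>i\<in>UNIV. t $ i * \<phi> (s $ i / t $ i))"

lemma phi_div_eq_phi_sum:
  assumes "\<And>i. 0 < t $ i"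
  shows "phi_div \<phi> s t = ereal (phi_sum \<phi> s t)"
  using assms by (simp add: phi_div_def phi_f_def phi_sum_def)

text \<open>The gradient of \<open>phi_sum \<phi> s t\<close> in \<open>s\<close>: the weight
  \<open>t $ i\<close> cancels the inner derivative \<open>1 / t $ i\<close>.\<close>

definition phi_slope :: "(real \<Rightarrow> real) \<Rightarrow> real ^ 'm \<Rightarrow> real ^ 'm \<Rightarrow> real ^ 'm" where
  "phi_slope \<phi> s t = (\<chi> i. deriv \<phi> (s $ i / t $ i))"

text \<open>The gradient of the divergence in the parameter, as the chain rule gives it.\<close>

definition phi_score ::
  "(real \<Rightarrow> real) \<Rightarrow> (real ^ 'k \<Rightarrow> real ^ 'm) \<Rightarrow> real ^ 'k \<Rightarrow> real ^ 'm \<Rightarrow> real ^ 'k" where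
  "phi_score \<phi> S \<theta> t = transpose (jacobian S (at \<theta>)) *v phi_slope \<phi> (S \<theta>) t"

text \<open>The Jacobian of the score in \<open>\<theta>\<close> by the product rule: the first
  summand differentiates the slope, the second the columns of the Jacobian of \<open>S\<close>. Row
  \<open>j\<close> belongs to component \<open>j\<close> of the score.\<close>

definition phi_score_jac ::
  "(real \<Rightarrow> real) \<Rightarrow> (real ^ 'k \<Rightarrow> real ^ 'm) \<Rightarrow> real ^ 'k \<Rightarrow> real ^ 'm \<Rightarrow> real ^ 'k ^ 'k" where
  "phi_score_jac \<phi> S \<theta> t =
     transpose (jacobian S (at \<theta>)) **
       diag_matrix (\<lambda>i. deriv (deriv \<phi>) (S \<theta> $ i / t $ i) / t $ i) ** jacobian S (at \<theta>) +
     (\<chi> j. phi_slope \<phi> (S \<theta>) t v* jacobian (\<lambda>x. column j (jacobian S (at x))) (at \<theta>))"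

text \<open>Isolates the smooth situation on an open set, later the interior of
  \<open>\<Theta>\<close>. For positive \<open>t\<close>, positivity of \<open>S\<close> keeps the
  quotients \<open>S \<theta> $ i / t $ i\<close> in the half-line where \<open>\<phi>\<close> is
  twice continuously differentiable.\<close>

locale phi_family =
  fixes \<phi> :: "real \<Rightarrow> real" and S :: "real ^ 'k \<Rightarrow> real ^ 'm" and U :: "(real ^ 'k) set"
  assumes open_U: "open U"
    and C2_phi: "C2_real_on {0<..} \<phi>"
    and C2_S: "C2_on U S"
    and S_pos: "\<And>\<theta> i. \<theta> \<in> U \<Longrightarrow> 0 < S \<theta> $ i"
begin

lemma phi_deriv:
  assumes "0 < x"
  shows "(\<phi> has_real_derivative deriv \<phi> x) (at x)"
    and "(deriv \<phi> has_real_derivative deriv (deriv \<phi>) x) (at x)"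
    and "isCont (deriv (deriv \<phi>)) x"
  using C2_phi assms
  by (auto simp: C2_real_on_def differentiable_on_def at_within_open[OF _ open_greaterThan]
      DERIV_deriv_iff_real_differentiable continuous_on_eq_continuous_at)

lemma S_deriv:
  assumes "\<theta> \<in> U"
  shows "(S has_derivative (*v) (jacobian S (at \<theta>))) (at \<theta>)"
    and "((\<lambda>x. column j (jacobian S (at x))) has_derivative
           (*v) (jacobian (\<lambda>x. column j (jacobian S (at x))) (at \<theta>))) (at \<theta>)"
    and "isCont (\<lambda>x. jacobian S (at x)) \<theta>"
    and "isCont (\<lambda>x. jacobian (\<lambda>x. column j (jacobian S (at x))) (at x)) \<theta>"
  using C2_S assms open_U
  by (auto simp: C2_on_def C1_on_def jacobian_works[symmetric] continuous_on_eq_continuous_at)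

lemma has_derivative_phi_sum:
  assumes \<theta>: "\<theta> \<in> U" and t: "\<And>i. 0 < t $ i"
  shows "((\<lambda>x. phi_sum \<phi> (S x) t) has_derivative (\<lambda>h. phi_score \<phi> S \<theta> t \<bullet> h)) (at \<theta>)"
proof -
  let ?J = "jacobian S (at \<theta>)"
  have *: "((\<lambda>x. t $ i * \<phi> (S x $ i / t $ i)) has_derivative
      (\<lambda>h. phi_slope \<phi> (S \<theta>) t $ i * (?J *v h) $ i)) (at \<theta>)" for i
  proof -
    have "((\<lambda>x. S x $ i / t $ i) has_derivative (\<lambda>h. (?J *v h) $ i / t $ i)) (at \<theta>)"
      using bounded_linear.has_derivative[OF bounded_linear_divide
        bounded_linear.has_derivative[OF bounded_linear_vec_nth S_deriv(1)[OF \<theta>]]] .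
    then have "((\<lambda>x. \<phi> (S x $ i / t $ i)) has_derivative
        (\<lambda>h. (?J *v h) $ i / t $ i * deriv \<phi> (S \<theta> $ i / t $ i))) (at \<theta>)"
      using S_pos[OF \<theta>] t by (intro DERIV_compose_FDERIV phi_deriv) auto
    then have "((\<lambda>x. t $ i * \<phi> (S x $ i / t $ i)) has_derivative
        (\<lambda>h. t $ i * ((?J *v h) $ i / t $ i * deriv \<phi> (S \<theta> $ i / t $ i)))) (at \<theta>)"
      by (rule has_derivative_mult_right)
    then show ?thesis
      using t[of i] by (simp add: phi_slope_def mult.commute less_imp_neq[symmetric])
  qed
  have "((\<lambda>x. phi_sum \<phi> (S x) t) has_derivative
      (\<lambda>h. \<Sum>i\<in>UNIV. phi_slope \<phi> (S \<theta>) t $ i * (?J *v h) $ i)) (at \<theta>)"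
    unfolding phi_sum_def by (rule has_derivative_sum) (rule *)
  moreover have "(\<Sum>i\<in>UNIV. phi_slope \<phi> (S \<theta>) t $ i * (?J *v h) $ i) = phi_score \<phi> S \<theta> t \<bullet> h" for h
  proof -
    have "phi_score \<phi> S \<theta> t \<bullet> h = phi_slope \<phi> (S \<theta>) t \<bullet> (?J *v h)"
      by (simp add: phi_score_def dot_lmul_matrix)
    then show ?thesis
      by (simp add: inner_vec_def)
  qed
  ultimately show ?thesis
    by simp
qed

text \<open>Component \<open>j\<close> of the score is the inner product of column \<open>j\<close>
  of the Jacobian of \<open>S\<close> with the slope, so the product rule applies. The derivative is
  joint in both variables, as implicit differentiation requires. Its \<open>t\<close>-part is
  negative because differentiating the quotient \<open>s / t\<close> in \<open>t\<close> gives
  \<open>- s / t^2\<close>, the source of \<open>phi_Delta\<close>.\<close>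

lemma has_derivative_phi_score:
  assumes \<theta>: "\<theta> \<in> U" and t: "\<And>i. 0 < t $ i"
  shows "((\<lambda>z. phi_score \<phi> S (fst z) (snd z)) has_derivative
     (\<lambda>z. phi_score_jac \<phi> S \<theta> t *v fst z +
        - (transpose (jacobian S (at \<theta>)) ** phi_Delta \<phi> (S \<theta>) t) *v snd z)) (at (\<theta>, t))"
proof (rule has_derivative_vec_componentwise)
  fix j
  let ?J = "jacobian S (at \<theta>)" and ?z = "(\<theta>, t)"
  let ?C = "\<lambda>x. column j (jacobian S (at x))"
  let ?D = "\<lambda>i. deriv (deriv \<phi>) (S \<theta> $ i / t $ i)"
  let ?R = "\<lambda>h. diag_matrix (\<lambda>i. ?D i / t $ i) *v (?J *v fst h) - phi_Delta \<phi> (S \<theta>) t *v snd h"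
  have slope: "((\<lambda>z. phi_slope \<phi> (S (fst z)) (snd z)) has_derivative ?R) (at ?z)"
  proof (rule has_derivative_vec_componentwise)
    fix i
    have "((\<lambda>z. S (fst z)) has_derivative (\<lambda>h. ?J *v fst h)) (at ?z)"
      using S_deriv(1)[OF \<theta>] by (intro has_derivative_compose[OF has_derivative_fst]) auto
    then have 1: "((\<lambda>z. S (fst z) $ i) has_derivative (\<lambda>h. (?J *v fst h) $ i)) (at ?z)"
      by (rule bounded_linear.has_derivative[OF bounded_linear_vec_nth])
    have 2: "((\<lambda>z. snd z $ i) has_derivative (\<lambda>h. snd h $ i)) (at ?z)"
      by (rule bounded_linear.has_derivative[OF bounded_linear_vec_nth]) (auto intro: derivative_intros)
    have "((\<lambda>z. S (fst z) $ i / snd z $ i) has_derivative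
       (\<lambda>h. ((?J *v fst h) $ i * t $ i - S \<theta> $ i * snd h $ i) / (t $ i * t $ i))) (at ?z)"
      using has_derivative_divide'[OF 1 2] t[of i] by simp
    from DERIV_compose_FDERIV[OF _ this, of "deriv \<phi>" "?D i"]
    have "((\<lambda>z. deriv \<phi> (S (fst z) $ i / snd z $ i)) has_derivative
       (\<lambda>h. ((?J *v fst h) $ i * t $ i - S \<theta> $ i * snd h $ i) / (t $ i * t $ i) * ?D i)) (at ?z)"
      using S_pos[OF \<theta>] t phi_deriv(2) by simp
    also have "(\<lambda>h. ((?J *v fst h) $ i * t $ i - S \<theta> $ i * snd h $ i) / (t $ i * t $ i) * ?D i)
        = (\<lambda>h. ?R h $ i)"
      using t[of i]
      by (simp add: diag_matrix_mult_nth phi_Delta_def fun_eq_iff field_simps power2_eq_square)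
    finally show "((\<lambda>z. phi_slope \<phi> (S (fst z)) (snd z) $ i) has_derivative (\<lambda>h. ?R h $ i)) (at ?z)"
      by (simp add: phi_slope_def)
  qed
  have "((\<lambda>z. ?C (fst z)) has_derivative (\<lambda>h. jacobian ?C (at \<theta>) *v fst h)) (at ?z)"
    using S_deriv(2)[OF \<theta>] by (intro has_derivative_compose[OF has_derivative_fst]) auto
  from has_derivative_inner[OF this slope]
  have "((\<lambda>z. phi_score \<phi> S (fst z) (snd z) $ j) has_derivative
     (\<lambda>h. ?C \<theta> \<bullet> ?R h + (jacobian ?C (at \<theta>) *v fst h) \<bullet> phi_slope \<phi> (S \<theta>) t)) (at ?z)"
    by (simp only: phi_score_def transpose_mult_nth fst_conv snd_conv)
  also have "(\<lambda>h. ?C \<theta> \<bullet> ?R h + (jacobian ?C (at \<theta>) *v fst h) \<bullet> phi_slope \<phi> (S \<theta>) t) =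
     (\<lambda>h. (phi_score_jac \<phi> S \<theta> t *v fst h +
        - (transpose ?J ** phi_Delta \<phi> (S \<theta>) t) *v snd h) $ j)"
  proof
    fix h
    \<comment> \<open>\<open>R\<close> gathers the terms in which the slope is differentiated, in
      both variables; \<open>C\<close> is the term in which the column is.\<close>
    have R: "(transpose ?J ** diag_matrix (\<lambda>i. ?D i / t $ i) ** ?J) *v fst h -
        (transpose ?J ** phi_Delta \<phi> (S \<theta>) t) *v snd h = transpose ?J *v ?R h"
      by (simp add: matrix_vector_mul_assoc matrix_vector_mult_diff_distrib matrix_mul_assoc)
    have C: "((\<chi> j. phi_slope \<phi> (S \<theta>) t v* jacobian (\<lambda>x. column j (jacobian S (at x))) (at \<theta>))
        *v fst h) $ j = (jacobian ?C (at \<theta>) *v fst h) \<bullet> phi_slope \<phi> (S \<theta>) t"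
      by (simp add: matrix_vector_mul_component dot_lmul_matrix inner_commute[of _ "phi_slope _ _ _"])
    show "?C \<theta> \<bullet> ?R h + (jacobian ?C (at \<theta>) *v fst h) \<bullet> phi_slope \<phi> (S \<theta>) t =
       (phi_score_jac \<phi> S \<theta> t *v fst h +
        - (transpose ?J ** phi_Delta \<phi> (S \<theta>) t) *v snd h) $ j"
      unfolding phi_score_jac_def transpose_mult_nth[symmetric] R[symmetric] C[symmetric]
      by (simp add: matrix_vector_mult_add_rdistrib uminus_matrix_vector_mult)
  qed
  finally show "((\<lambda>z. phi_score \<phi> S (fst z) (snd z) $ j) has_derivative
     (\<lambda>h. (phi_score_jac \<phi> S \<theta> t *v fst h +
        - (transpose ?J ** phi_Delta \<phi> (S \<theta>) t) *v snd h) $ j)) (at ?z)" .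
qed

text \<open>In \<open>hessian\<close> the outer derivative is the row index, in the Jacobian of the
  score it is the column index; hence the transpose. Equality of mixed partial derivatives is not
  invoked.\<close>

lemma phi_hessian_eq:
  assumes \<theta>: "\<theta> \<in> U" and t: "\<And>i. 0 < t $ i"
  shows "phi_hessian \<phi> S t \<theta> = transpose (phi_score_jac \<phi> S \<theta> t)"
proof -
  have eq: "(\<lambda>x. real_of_ereal (phi_div \<phi> (S x) t)) = (\<lambda>x. phi_sum \<phi> (S x) t)"
    using t by (simp add: phi_div_eq_phi_sum)
  have 1: "partial_deriv j (\<lambda>x. phi_sum \<phi> (S x) t) x = phi_score \<phi> S x t $ j" if "x \<in> U" for x j
    using partial_deriv_eq[OF has_derivative_phi_sum[OF that t], of j] by (simp add: inner_axis)
  have "((\<lambda>x. phi_score \<phi> S x t) has_derivative (\<lambda>h. phi_score_jac \<phi> S \<theta> t *v h)) (at \<theta>)"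
    using has_derivative_compose[of "\<lambda>x. (x, t)" "\<lambda>h. (h, 0)" \<theta> UNIV, OF _ has_derivative_phi_score[OF \<theta> t]]
    by (simp add: has_derivative_Pair)
  then have 2: "((\<lambda>x. phi_score \<phi> S x t $ j) has_derivative
      (\<lambda>h. (phi_score_jac \<phi> S \<theta> t *v h) $ j)) (at \<theta>)" for j
    by (rule bounded_linear.has_derivative[OF bounded_linear_vec_nth])
  \<comment> \<open>The inner partial derivative is identified with the score on the open set
    \<open>U\<close>, which suffices for differentiating once more at
    \<open>\<theta>\<close>.\<close>
  have "partial_deriv i (partial_deriv j (\<lambda>x. phi_sum \<phi> (S x) t)) \<theta> =
      phi_score_jac \<phi> S \<theta> t $ j $ i" for i j
    using partial_deriv_eq[OF has_derivative_transform_within_open[OF 2 open_U \<theta> 1[symmetric]], of i]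
    by (simp add: matrix_vector_mult_basis column_def)
  then show ?thesis
    by (simp add: phi_hessian_def eq hessian_def transpose_def)
qed

text \<open>The filter and both moving arguments are arbitrary, so that the minimizer can be put for
  \<open>g\<close> and its own argument for \<open>u\<close>. The quotients have positive limits,
  where the first two derivatives of \<open>\<phi>\<close> are continuous.\<close>

lemma tendsto_phi_score_jac:
  assumes g: "(g \<longlongrightarrow> \<theta>) F" and u: "(u \<longlongrightarrow> t) F" and \<theta>: "\<theta> \<in> U" and t: "\<And>i. 0 < t $ i"
  shows "((\<lambda>x. phi_score_jac \<phi> S (g x) (u x)) \<longlongrightarrow> phi_score_jac \<phi> S \<theta> t) F"
    and "((\<lambda>x. phi_Delta \<phi> (S (g x)) (u x)) \<longlongrightarrow> phi_Delta \<phi> (S \<theta>) t) F"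
    and "((\<lambda>x. jacobian S (at (g x))) \<longlongrightarrow> jacobian S (at \<theta>)) F"
proof -
  note tr = isCont_tendsto_compose[OF _ g]
  have S: "((\<lambda>x. S (g x)) \<longlongrightarrow> S \<theta>) F"
    using tr has_derivative_continuous[OF S_deriv(1)[OF \<theta>]] by blast
  have quot: "((\<lambda>x. S (g x) $ i / u x $ i) \<longlongrightarrow> S \<theta> $ i / t $ i) F" for i
    using t[of i] by (intro tendsto_intros S u) simp
  have pos: "0 < S \<theta> $ i / t $ i" for i
    using S_pos[OF \<theta>] t by simp
  have p1: "((\<lambda>x. deriv \<phi> (S (g x) $ i / u x $ i)) \<longlongrightarrow> deriv \<phi> (S \<theta> $ i / t $ i)) F" for i
    using isCont_tendsto_compose[OF DERIV_isCont[OF phi_deriv(2)[OF pos]] quot] .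
  have p2: "((\<lambda>x. deriv (deriv \<phi>) (S (g x) $ i / u x $ i)) \<longlongrightarrow>
      deriv (deriv \<phi>) (S \<theta> $ i / t $ i)) F" for i
    using isCont_tendsto_compose[OF phi_deriv(3)[OF pos] quot] .
  show J: "((\<lambda>x. jacobian S (at (g x))) \<longlongrightarrow> jacobian S (at \<theta>)) F"
    by (rule tr[OF S_deriv(3)[OF \<theta>]])
  have diag: "((\<lambda>x. diag_matrix (d x)) \<longlongrightarrow> diag_matrix e) F"
    if "\<And>i. ((\<lambda>x. d x i) \<longlongrightarrow> e i) F" for d :: "_ \<Rightarrow> 'm \<Rightarrow> real" and e
  proof (intro vec_tendstoI)
    fix i j show "((\<lambda>x. diag_matrix (d x) $ i $ j) \<longlongrightarrow> diag_matrix e $ i $ j) F"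
      using that by (simp add: diag_matrix_def)
  qed
  have t0: "t $ i \<noteq> 0" for i using t[of i] by simp
  show "((\<lambda>x. phi_Delta \<phi> (S (g x)) (u x)) \<longlongrightarrow> phi_Delta \<phi> (S \<theta>) t) F"
    unfolding phi_Delta_def using t0 by (intro diag tendsto_intros p2 S u) auto
  have slope: "((\<lambda>x. phi_slope \<phi> (S (g x)) (u x)) \<longlongrightarrow> phi_slope \<phi> (S \<theta>) t) F"
    unfolding phi_slope_def by (intro vec_tendstoI) (simp add: p1)
  have "((\<lambda>x. diag_matrix (\<lambda>i. deriv (deriv \<phi>) (S (g x) $ i / u x $ i) / u x $ i)) \<longlongrightarrow>
      diag_matrix (\<lambda>i. deriv (deriv \<phi>) (S \<theta> $ i / t $ i) / t $ i)) F"
    by (intro diag tendsto_divide tendsto_vec_nth p2 u t0)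
  moreover have "((\<lambda>x. transpose (jacobian S (at (g x)))) \<longlongrightarrow> transpose (jacobian S (at \<theta>))) F"
    unfolding transpose_def by (intro tendsto_vec_lambda tendsto_vec_nth J)
  moreover have "((\<lambda>x. \<chi> j. phi_slope \<phi> (S (g x)) (u x) v*
        jacobian (\<lambda>x. column j (jacobian S (at x))) (at (g x))) \<longlongrightarrow>
      (\<chi> j. phi_slope \<phi> (S \<theta>) t v* jacobian (\<lambda>x. column j (jacobian S (at x))) (at \<theta>))) F"
    unfolding vector_matrix_mult_def
    by (intro tendsto_vec_lambda tendsto_sum tendsto_mult tendsto_vec_nth slope
        tr[OF S_deriv(4)[OF \<theta>]])
  ultimately show "((\<lambda>x. phi_score_jac \<phi> S (g x) (u x)) \<longlongrightarrow> phi_score_jac \<phi> S \<theta> t) F"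
    unfolding phi_score_jac_def by (intro tendsto_add tendsto_matrix_matrix_mult J)
qed

end

section \<open>Projections as minimizers, and their parameters\<close>

text \<open>Connects the infimum in the notion of projection with the choice operator behind
  \<open>phi_proj\<close> and \<open>theta_star\<close>.\<close>

lemma is_phi_projection_iff_is_arg_min:
  "is_phi_projection \<phi> M t s \<longleftrightarrow> is_arg_min (\<lambda>s. phi_div \<phi> s t) (\<lambda>s. s \<in> M) s"
  unfolding is_phi_projection_def is_arg_min_linorder
  by (auto simp: INF_lower intro!: antisym INF_greatest INF_lower)

text \<open>The projection is the image of an interior point, so minimizing over the interior
  reaches the minimum over the closure. Hence the image of \<open>theta_star\<close> is again a
  projection; uniqueness identifies the images, and injectivity the parameters.\<close>

lemma phi_proj_and_theta_star:
  assumes proj: "\<exists>!s. is_phi_projection \<phi> (S ` closure \<Theta>) t s"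
    and attained: "phi_proj \<phi> (S ` closure \<Theta>) t \<in> S ` interior \<Theta>"
    and inj: "inj_on S (closure \<Theta>)"
  shows "theta_star \<phi> S \<Theta> t \<in> interior \<Theta>"
    and "S (theta_star \<phi> S \<Theta> t) = phi_proj \<phi> (S ` closure \<Theta>) t"
    and "\<And>x. x \<in> closure \<Theta> \<Longrightarrow> phi_div \<phi> (S (theta_star \<phi> S \<Theta> t)) t \<le> phi_div \<phi> (S x) t"
    and "\<And>x. x \<in> closure \<Theta> \<Longrightarrow> phi_div \<phi> (S x) t \<le> phi_div \<phi> (S (theta_star \<phi> S \<Theta> t)) t \<Longrightarrow>
           x = theta_star \<phi> S \<Theta> t"
proof -
  let ?M = "S ` closure \<Theta>" and ?th = "theta_star \<phi> S \<Theta> t"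
  let ?s = "phi_proj \<phi> ?M t"
  have sub: "interior \<Theta> \<subseteq> closure \<Theta>"
    using interior_subset closure_subset by blast
  have s: "is_phi_projection \<phi> ?M t ?s"
    using proj unfolding phi_proj_def arg_min_on_def arg_min_def is_phi_projection_iff_is_arg_min
    by (metis someI_ex)
  then have s_min: "phi_div \<phi> ?s t \<le> phi_div \<phi> (S x) t" if "x \<in> closure \<Theta>" for x
    using that by (auto simp: is_phi_projection_iff_is_arg_min is_arg_min_linorder)
  obtain x0 where x0: "x0 \<in> interior \<Theta>" "S x0 = ?s"
    using attained by auto
  \<comment> \<open>The witness \<open>x0\<close> shows that interior minimizers exist, so the
    choice made by \<open>theta_star\<close> is one of them.\<close>
  have "is_arg_min (\<lambda>\<theta>. phi_div \<phi> (S \<theta>) t) (\<lambda>\<theta>. \<theta> \<in> interior \<Theta>) x0"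
    using x0 s_min sub by (auto simp: is_arg_min_linorder)
  then have "is_arg_min (\<lambda>\<theta>. phi_div \<phi> (S \<theta>) t) (\<lambda>\<theta>. \<theta> \<in> interior \<Theta>) ?th"
    unfolding theta_star_def arg_min_on_def arg_min_def by (rule someI)
  then have th: "?th \<in> interior \<Theta>" and le: "phi_div \<phi> (S ?th) t \<le> phi_div \<phi> ?s t"
    using x0 by (auto simp: is_arg_min_linorder simp flip: x0(2))
  have unique: "S x = ?s" if "x \<in> closure \<Theta>" "phi_div \<phi> (S x) t \<le> phi_div \<phi> ?s t" for x
  proof -
    have "is_phi_projection \<phi> ?M t (S x)"
      using that s_min
      by (auto simp: is_phi_projection_iff_is_arg_min is_arg_min_linorder intro: order_trans)
    with proj s show ?thesis by blast
  qed
  show "?th \<in> interior \<Theta>" by fact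
  show Sth: "S ?th = ?s" using unique th le sub by blast
  show "phi_div \<phi> (S ?th) t \<le> phi_div \<phi> (S x) t" if "x \<in> closure \<Theta>" for x
    using s_min[OF that] by (simp add: Sth)
  show "x = ?th" if "x \<in> closure \<Theta>" "phi_div \<phi> (S x) t \<le> phi_div \<phi> (S ?th) t" for x
    using unique[OF that(1)] that th sub inj by (metis Sth inj_onD subsetD)
qed

section \<open>Differentiability of the projection and of its parameter\<close>

theorem corollary20:
  fixes \<phi> :: "real \<Rightarrow> real"
    and \<Theta> :: "(real ^ 'k) set"
    and S :: "real ^ 'k \<Rightarrow> real ^ 'm"
    and t0 :: "real ^ 'm"
    and N :: "(real ^ 'm) set"
  assumes "convex_on {0..} \<phi>"
    and "continuous (at 0 within {0..}) \<phi>"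
    and "strictly_convex_on {0<..} \<phi>"
    and "C2_real_on {0<..} \<phi>"
    and "CARD('k) \<le> CARD('m)"
    and "bounded \<Theta>"
    and "interior \<Theta> \<noteq> {}"
    and "S ` closure \<Theta> \<subseteq> {s. \<forall>i. 0 \<le> s $ i \<and> s $ i \<le> 1}"
    and "continuous_on (closure \<Theta>) S"
    and "inj_on S (closure \<Theta>)"
    and "C2_on (interior \<Theta>) S"
    and "S ` interior \<Theta> \<subseteq> {s. \<forall>i. 0 < s $ i \<and> s $ i < 1}"
    and "\<forall>i. 0 < t0 $ i \<and> t0 $ i < 1"
    and "open N" and "t0 \<in> N"
    and "N \<subseteq> {t. \<forall>i. 0 < t $ i \<and> t $ i < 1}"
    and "\<forall>t\<in>N. (\<exists>!s. is_phi_projection \<phi> (S ` closure \<Theta>) t s) \<and>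
           (\<exists>!\<theta>. \<theta> \<in> interior \<Theta> \<and> phi_proj \<phi> (S ` closure \<Theta>) t = S \<theta>)"
    and "positive_definite (phi_hessian \<phi> S t0 (theta_star \<phi> S \<Theta> t0))"
  shows "continuously_differentiable_at (phi_proj \<phi> (S ` closure \<Theta>)) t0 \<and>
    jacobian (phi_proj \<phi> (S ` closure \<Theta>)) (at t0) =
      jacobian S (at (theta_star \<phi> S \<Theta> t0)) ** jacobian (theta_star \<phi> S \<Theta>) (at t0) \<and>
    theta_star \<phi> S \<Theta> differentiable (at t0) \<and>
    jacobian (theta_star \<phi> S \<Theta>) (at t0) =
      matrix_inv (phi_hessian \<phi> S t0 (theta_star \<phi> S \<Theta> t0)) **
      transpose (jacobian S (at (theta_star \<phi> S \<Theta> t0))) **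
      phi_Delta \<phi> (S (theta_star \<phi> S \<Theta> t0)) t0"
proof -
  let ?p = "phi_proj \<phi> (S ` closure \<Theta>)"
  define \<theta> where "\<theta> = theta_star \<phi> S \<Theta>"
  interpret phi_family \<phi> S "interior \<Theta>"
    using assms by unfold_locales auto
  have t_pos: "0 < t $ i" if "t \<in> N" for t i
    using that assms(16) by auto
  have attained: "?p t \<in> S ` interior \<Theta>" if "t \<in> N" for t
    using that assms(17) by blast
  have proj: "\<exists>!s. is_phi_projection \<phi> (S ` closure \<Theta>) t s" if "t \<in> N" for t
    using that assms(17) by blast
  have star: "\<theta> t \<in> interior \<Theta>" "S (\<theta> t) = ?p t"
      "\<And>x. x \<in> closure \<Theta> \<Longrightarrow> phi_sum \<phi> (S (\<theta> t)) t \<le> phi_sum \<phi> (S x) t"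
      "\<And>x. x \<in> closure \<Theta> \<Longrightarrow> phi_sum \<phi> (S x) t \<le> phi_sum \<phi> (S (\<theta> t)) t \<Longrightarrow> x = \<theta> t"
    if "t \<in> N" for t
    using phi_proj_and_theta_star[OF proj[OF that] attained[OF that] assms(10)] t_pos[OF that]
    by (simp_all add: phi_div_eq_phi_sum \<theta>_def)
  have sub: "interior \<Theta> \<subseteq> closure \<Theta>"
    using interior_subset closure_subset by blast
  \<comment> \<open>Components of \<open>S\<close> may vanish on the boundary of
    \<open>\<Theta>\<close>, so continuity of \<open>\<phi>\<close> is wanted up to 0: there it is a
    hypothesis, elsewhere it follows from differentiability.\<close>
  have phi_cont: "continuous_on {0..} \<phi>"
    unfolding continuous_on_eq_continuous_within
  proof
    fix x :: real assume "x \<in> {0..}"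
    then consider "x = 0" | "0 < x" by force
    then show "continuous (at x within {0..}) \<phi>"
      by cases (use assms(2) DERIV_isCont[OF phi_deriv(1)] in \<open>auto intro: continuous_at_imp_continuous_within\<close>)
  qed
  have "continuous_on N \<theta>"
  proof (rule continuous_on_unique_minimizer)
    show "compact (closure \<Theta>)"
      using \<open>bounded \<Theta>\<close> by simp
    have "continuous_on (N \<times> closure \<Theta>) (\<lambda>z. S (snd z))"
      by (rule continuous_on_compose2[OF assms(9)]) (auto intro: continuous_intros)
    then have "continuous_on (N \<times> closure \<Theta>) (\<lambda>z. S (snd z) $ i / fst z $ i)" for i
      using t_pos by (intro continuous_intros) (auto simp: less_imp_neq[symmetric])
    then have "continuous_on (N \<times> closure \<Theta>) (\<lambda>z. \<phi> (S (snd z) $ i / fst z $ i))" for i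
      by (rule continuous_on_compose2[OF phi_cont])
        (use assms(8) t_pos in \<open>auto intro!: divide_nonneg_pos\<close>)
    then show "continuous_on (N \<times> closure \<Theta>) (\<lambda>(t, x). phi_sum \<phi> (S x) t)"
      unfolding phi_sum_def case_prod_unfold by (intro continuous_intros)
  qed (use star sub in auto)
  then have cont: "isCont \<theta> t" if "t \<in> N" for t
    using that \<open>open N\<close> by (simp add: continuous_on_eq_continuous_at)
  have score: "phi_score \<phi> S (\<theta> t) t = 0" if t: "t \<in> N" for t
  proof -
    have "(\<lambda>h. phi_score \<phi> S (\<theta> t) t \<bullet> h) = (\<lambda>h. 0)"
    proof (rule differential_zero_maxmin)
      show "((\<lambda>x. phi_sum \<phi> (S x) t) has_derivative (\<lambda>h. phi_score \<phi> S (\<theta> t) t \<bullet> h)) (at (\<theta> t))"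
        by (intro has_derivative_phi_sum star t t_pos)
      show "(\<forall>x\<in>interior \<Theta>. phi_sum \<phi> (S x) t \<le> phi_sum \<phi> (S (\<theta> t)) t) \<or>
          (\<forall>x\<in>interior \<Theta>. phi_sum \<phi> (S (\<theta> t)) t \<le> phi_sum \<phi> (S x) t)"
        using star(3)[OF t] sub by (intro disjI2) auto
    qed (use star(1)[OF t] in auto)
    then show ?thesis
      by (metis inner_eq_zero_iff)
  qed
  define A where "A t = phi_score_jac \<phi> S (\<theta> t) t" for t
  \<comment> \<open>The candidate for the Jacobian of \<open>\<theta>\<close> at \<open>t\<close>,
    with \<open>A t\<close> in the place of the Hessian; at \<open>t0\<close> the two
    coincide.\<close>
  define G where "G t = matrix_inv (A t) ** transpose (jacobian S (at (\<theta> t))) **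
      phi_Delta \<phi> (S (\<theta> t)) t" for t
  have limits: "(A \<longlongrightarrow> A t) (at t)" "((\<lambda>t. phi_Delta \<phi> (S (\<theta> t)) t) \<longlongrightarrow> phi_Delta \<phi> (S (\<theta> t)) t) (at t)"
      "((\<lambda>t. jacobian S (at (\<theta> t))) \<longlongrightarrow> jacobian S (at (\<theta> t))) (at t)" if t: "t \<in> N" for t
    unfolding A_def
    using tendsto_phi_score_jac[OF _ tendsto_ident_at star(1) t_pos, OF _ t t] cont[OF t]
    by (simp_all add: isCont_def)
  \<comment> \<open>The Hessian is the transpose of \<open>A t0\<close>; the symmetry clause of
    \<open>positive_definite\<close> removes the transpose.\<close>
  have H: "phi_hessian \<phi> S t0 (\<theta> t0) = A t0"
    using phi_hessian_eq[OF star(1) t_pos, OF \<open>t0 \<in> N\<close> \<open>t0 \<in> N\<close>] assms(18)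
    unfolding positive_definite_def \<theta>_def[symmetric] A_def by (metis transpose_transpose)
  have det: "det (A t0) \<noteq> 0"
    using assms(18) by (intro positive_definite_det_nz) (simp add: \<theta>_def flip: H)
  \<comment> \<open>Proved at every admissible \<open>t\<close>, not only at \<open>t0\<close>,
    because continuous differentiability concerns the Jacobian on a neighborhood.\<close>
  have deriv: "(\<theta> has_derivative (*v) (G t)) (at t)" if t: "t \<in> N" and nz: "det (A t) \<noteq> 0" for t
  proof -
    let ?B = "transpose (jacobian S (at (\<theta> t))) ** phi_Delta \<phi> (S (\<theta> t)) t"
    have "(\<theta> has_derivative (\<lambda>k. - (matrix_inv (A t) *v (- ?B *v k)))) (at t)"
    proof (rule has_derivative_implicit[where A = "(*v) (A t)" and B = "(*v) (- ?B)"
          and A' = "(*v) (matrix_inv (A t))" and F = "\<lambda>z. phi_score \<phi> S (fst z) (snd z)"])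
      show "((\<lambda>z. phi_score \<phi> S (fst z) (snd z)) has_derivative
          (\<lambda>z. A t *v fst z + - ?B *v snd z)) (at (\<theta> t, t))"
        unfolding A_def by (intro has_derivative_phi_score star t t_pos)
      have "\<forall>\<^sub>F u in at t. u \<in> N"
        using t \<open>open N\<close> by (simp add: eventually_at_in_open')
      then show "\<forall>\<^sub>F u in at t. phi_score \<phi> S (fst (\<theta> u, u)) (snd (\<theta> u, u)) =
          phi_score \<phi> S (fst (\<theta> t, t)) (snd (\<theta> t, t))"
        by eventually_elim (simp add: score t)
      show "matrix_inv (A t) *v (A t *v x) = x" for x
        using matrix_inv_mult(2)[OF nz] by (simp add: matrix_vector_mul_assoc)
    qed (use cont t in auto)
    then show ?thesis
      \<comment> \<open>The minus sign in \<open>- ?B\<close> cancels the one from implicit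
        differentiation.\<close>
      by (simp add: G_def uminus_matrix_vector_mult matrix_vector_mul_assoc matrix_mul_assoc
          linear_neg[OF matrix_vector_mul_linear])
  qed
  \<comment> \<open>On the open set \<open>N\<close> the projection is the composition of
    \<open>S\<close> with \<open>\<theta>\<close>, so the chain rule gives its derivative.\<close>
  have p_deriv: "(?p has_derivative (*v) (jacobian S (at (\<theta> t)) ** G t)) (at t)"
    if t: "t \<in> N" and nz: "det (A t) \<noteq> 0" for t
  proof (rule has_derivative_transform_within_open[OF _ \<open>open N\<close> t])
    show "((\<lambda>u. S (\<theta> u)) has_derivative (*v) (jacobian S (at (\<theta> t)) ** G t)) (at t)"
      using has_derivative_compose[OF deriv[OF t nz] S_deriv(1)[OF star(1)[OF t]]]
      by (simp add: matrix_vector_mul_assoc)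
  qed (use star in auto)
  \<comment> \<open>Yields a neighborhood on which the derivative formula is valid throughout, so
    continuity of the Jacobian of \<open>?p\<close> at \<open>t0\<close> reduces to that of the
    explicit matrix product.\<close>
  have "\<forall>\<^sub>F t in nhds t0. t \<in> N \<and> det (A t) \<noteq> 0"
    unfolding eventually_conj_iff
    using tendsto_imp_eventually_ne[OF tendsto_det[OF limits(1)[OF \<open>t0 \<in> N\<close>]] det] det
      \<open>open N\<close> \<open>t0 \<in> N\<close>
    by (simp add: eventually_nhds_conv_at eventually_nhds_in_open eventually_at_in_open')
  then obtain V where V: "open V" "t0 \<in> V" "\<And>t. t \<in> V \<Longrightarrow> t \<in> N \<and> det (A t) \<noteq> 0"
    unfolding eventually_nhds by blast
  note jac = jacobian_eqI[OF p_deriv]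
  have "(G \<longlongrightarrow> G t0) (at t0)"
    unfolding G_def transpose_def
    by (intro tendsto_intros tendsto_matrix_matrix_mult tendsto_matrix_inv limits det \<open>t0 \<in> N\<close>)
  then have "((\<lambda>t. jacobian S (at (\<theta> t)) ** G t) \<longlongrightarrow> jacobian S (at (\<theta> t0)) ** G t0) (at t0)"
    by (intro tendsto_matrix_matrix_mult limits \<open>t0 \<in> N\<close>)
  moreover have "\<forall>\<^sub>F t in at t0. jacobian S (at (\<theta> t)) ** G t = jacobian ?p (at t)"
    using V by (intro eventually_at_in_open'[THEN eventually_mono, of V]) (auto simp: jac)
  ultimately have "isCont (\<lambda>t. jacobian ?p (at t)) t0"
    unfolding isCont_def jac[OF \<open>t0 \<in> N\<close> det] by (rule Lim_transform_eventually)
  then have "continuously_differentiable_at ?p t0"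
    unfolding continuously_differentiable_at_def using V p_deriv
    by (meson differentiableI)
  moreover have "jacobian \<theta> (at t0) = G t0"
    by (intro jacobian_eqI deriv \<open>t0 \<in> N\<close> det)
  moreover have "\<theta> differentiable (at t0)"
    using deriv[OF \<open>t0 \<in> N\<close> det] by (rule differentiableI)
  ultimately show ?thesis
    using jac[OF \<open>t0 \<in> N\<close> det] by (simp add: H G_def flip: \<theta>_def)
qed

end
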